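(* Every countable equivalence structure is relatively $\Delta^0_3$ bi-embeddably categorical.
   Context: An equivalence structure $\mathcal{A}=(A,E)$ has universe $A\subseteq\omega$ and an equivalence relation $E$ on $A$; structures are identified with their atomic diagrams. Two structures are bi-embeddable if each embeds into the other. A countable structure $\mathcal{A}$ is relatively $\Delta^0_3$ bi-embeddably categorical if for every structure $\mathcal{B}$ bi-embeddable with $\mathcal{A}$ there are embeddings $\mathcal{A}\hookrightarrow\mathcal{B}$ and $\mathcal{B}\hookrightarrow\mathcal{A}$ that are $\Delta^0_3$ relative to $\mathcal{A}\oplus\mathcal{B}$ (i.e., computable in $(\mathcal{A}\oplus\mathcal{B})''$). *)

theory Defs
  imports Main "HOL-Library.Nat_Bijection"
begin

datatype recf = Zero | Succ | Proj nat | Orc | Comp recf "recf list"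
  | Prim recf recf | Mn recf

inductive ev :: "(nat \<Rightarrow> bool) \<Rightarrow> recf \<Rightarrow> nat list \<Rightarrow> nat \<Rightarrow> bool"
  for Ora :: "nat \<Rightarrow> bool" where
  ev_zero: "ev Ora Zero xs 0"
| ev_succ: "ev Ora Succ (x # xs) (Suc x)"
| ev_proj: "i < length xs \<Longrightarrow> ev Ora (Proj i) xs (xs ! i)"
| ev_orc: "ev Ora Orc (x # xs) (if Ora x then 1 else 0)"
| ev_comp: "list_all2 (\<lambda>g y. ev Ora g xs y) gs ys \<Longrightarrow> ev Ora f ys z \<Longrightarrow> ev Ora (Comp f gs) xs z"
| ev_prim0: "ev Ora f xs y \<Longrightarrow> ev Ora (Prim f g) (0 # xs) y"
| ev_primS: "ev Ora (Prim f g) (n # xs) y \<Longrightarrow> ev Ora g (n # y # xs) z \<Longrightarrow> ev Ora (Prim f g) (Suc n # xs) z"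
| ev_mn: "ev Ora f (n # xs) 0 \<Longrightarrow> (\<forall>m<n. \<exists>y. 0 < y \<and> ev Ora f (m # xs) y) \<Longrightarrow> ev Ora (Mn f) xs n"

definition rel_computable :: "(nat \<Rightarrow> bool) \<Rightarrow> nat \<Rightarrow> (nat list \<Rightarrow> bool) \<Rightarrow> bool" where
  "rel_computable Ora k R \<longleftrightarrow>
     (\<exists>c. \<forall>xs. length xs = k \<longrightarrow> ev Ora c xs (if R xs then 1 else 0))"

definition Sigma3 :: "(nat \<Rightarrow> bool) \<Rightarrow> nat set \<Rightarrow> bool" where
  "Sigma3 Ora S \<longleftrightarrow> (\<exists>R. rel_computable Ora 4 R \<and>
      (\<forall>n. n \<in> S \<longleftrightarrow> (\<exists>a. \<forall>b. \<exists>c. R [n, a, b, c])))"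

definition Delta3 :: "(nat \<Rightarrow> bool) \<Rightarrow> nat set \<Rightarrow> bool" where
  "Delta3 Ora S \<longleftrightarrow> Sigma3 Ora S \<and> Sigma3 Ora (- S)"

definition Delta3_fun :: "(nat \<Rightarrow> bool) \<Rightarrow> (nat \<Rightarrow> nat) \<Rightarrow> bool" where
  "Delta3_fun Ora f \<longleftrightarrow> Delta3 Ora {prod_encode (x, f x) | x. True}"

definition equiv_structure :: "nat set \<Rightarrow> (nat \<times> nat) set \<Rightarrow> bool" where
  "equiv_structure U E \<longleftrightarrow> equiv U E"

definition diagram :: "nat set \<Rightarrow> (nat \<times> nat) set \<Rightarrow> nat \<Rightarrow> bool" where
  "diagram U E n = (if even n then n div 2 \<in> U else prod_decode (n div 2) \<in> E)"

definition join :: "(nat \<Rightarrow> bool) \<Rightarrow> (nat \<Rightarrow> bool) \<Rightarrow> nat \<Rightarrow> bool" where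
  "join A B n = (if even n then A (n div 2) else B (n div 2))"

definition is_embedding ::
  "nat set \<Rightarrow> (nat \<times> nat) set \<Rightarrow> nat set \<Rightarrow> (nat \<times> nat) set \<Rightarrow> (nat \<Rightarrow> nat) \<Rightarrow> bool" where
  "is_embedding U E V F f \<longleftrightarrow> f ` U \<subseteq> V \<and> inj_on f U \<and>
     (\<forall>x\<in>U. \<forall>y\<in>U. (x, y) \<in> E \<longleftrightarrow> (f x, f y) \<in> F)"

definition bi_embeddable :: "nat set \<Rightarrow> (nat \<times> nat) set \<Rightarrow> nat set \<Rightarrow> (nat \<times> nat) set \<Rightarrow> bool" where
  "bi_embeddable U E V F \<longleftrightarrow> (\<exists>f. is_embedding U E V F f) \<and> (\<exists>g. is_embedding V F U E g)"

definition rel_Delta3_bi_emb_categorical :: "nat set \<Rightarrow> (nat \<times> nat) set \<Rightarrow> bool" where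
  "rel_Delta3_bi_emb_categorical U E \<longleftrightarrow>
     (\<forall>V F. equiv_structure V F \<and> bi_embeddable U E V F \<longrightarrow>
        (\<exists>f g. is_embedding U E V F f \<and> is_embedding V F U E g \<and>
           Delta3_fun (join (diagram U E) (diagram V F)) f \<and>
           Delta3_fun (join (diagram U E) (diagram V F)) g))"

end

theory Submission
  imports Defs "HOL-Library.Extended_Nat"
begin

text \<open>An embedding of \<open>(U, E)\<close> into \<open>(V, F)\<close> already yields a \<open>\<Delta>\<^sub>3\<close> one. Call a class of \<open>E\<close>
  scarce if only finitely many classes of \<open>F\<close> are at least as large. Taking a smallest scarce class,
  the given embedding shows that there are only finitely many scarce classes, and they are matched
  with classes of \<open>F\<close> by a finite table. The other classes are matched greedily with unused classes of
  \<open>F\<close> that are at least as large. ``At least as large'' is a \<open>\<Pi>\<^sub>2\<close> condition, so a finite run of the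
  greedy matching can be certified by a code \<open>s\<close> listing the outcomes of the comparisons together
  with the \<open>\<Sigma>\<^sub>2\<close> witnesses of the failures; correctness of the certificate is \<open>\<Pi>\<^sub>2\<close>. Inside matched
  classes the \<open>j\<close>-th element goes to the \<open>j\<close>-th element. Hence the graph is \<open>\<Sigma>\<^sub>3\<close>, and since the
  function is total the graph is \<open>\<Delta>\<^sub>3\<close>.\<close>

section \<open>Closure properties of relative computability\<close>

definition computable :: "(nat \<Rightarrow> bool) \<Rightarrow> nat \<Rightarrow> (nat list \<Rightarrow> nat) \<Rightarrow> bool" where
  "computable Ora k f \<longleftrightarrow> (\<exists>c. \<forall>xs. length xs = k \<longrightarrow> ev Ora c xs (f xs))"

lemma rel_computable_iff:
  "rel_computable Ora k R \<longleftrightarrow> computable Ora k (\<lambda>xs. if R xs then 1 else 0)"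
  by (simp add: rel_computable_def computable_def)

lemma computable_cong:
  assumes "computable Ora k f" "\<And>xs. length xs = k \<Longrightarrow> f xs = g xs"
  shows "computable Ora k g"
  using assms by (auto simp: computable_def)

lemma computable_proj: "i < k \<Longrightarrow> computable Ora k (\<lambda>xs. xs ! i)"
  unfolding computable_def by (rule exI[of _ "Proj i"]) (auto intro: ev_proj)

lemma computable_compose:
  assumes "computable Ora m F" "length gs = m" "\<And>g. g \<in> set gs \<Longrightarrow> computable Ora k g"
  shows "computable Ora k (\<lambda>xs. F (map (\<lambda>g. g xs) gs))"
proof -
  obtain c where c: "\<And>xs. length xs = m \<Longrightarrow> ev Ora c xs (F xs)"
    using assms(1) by (auto simp: computable_def)
  obtain d where d: "\<And>g xs. g \<in> set gs \<Longrightarrow> length xs = k \<Longrightarrow> ev Ora (d g) xs (g xs)"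
    using assms(3) unfolding computable_def by metis
  have "ev Ora (Comp c (map d gs)) xs (F (map (\<lambda>g. g xs) gs))" if "length xs = k" for xs
  proof (rule ev_comp)
    show "list_all2 (\<lambda>g y. ev Ora g xs y) (map d gs) (map (\<lambda>g. g xs) gs)"
      using d that by (auto simp: list_all2_conv_all_nth)
    show "ev Ora c (map (\<lambda>g. g xs) gs) (F (map (\<lambda>g. g xs) gs))"
      using c assms(2) by simp
  qed
  then show ?thesis unfolding computable_def by blast
qed

lemma computable_compose1:
  assumes "computable Ora 1 (\<lambda>xs. F (xs ! 0))" "computable Ora k f"
  shows "computable Ora k (\<lambda>xs. F (f xs))"
  using computable_compose[OF assms(1), of "[f]" k] assms(2) by simp

lemma computable_compose2:
  assumes "computable Ora 2 (\<lambda>xs. F (xs ! 0) (xs ! 1))" "computable Ora k f" "computable Ora k g"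
  shows "computable Ora k (\<lambda>xs. F (f xs) (g xs))"
  using computable_compose[OF assms(1), of "[f, g]" k] assms(2,3) by auto

lemma computable_Suc:
  assumes "computable Ora k f"
  shows "computable Ora k (\<lambda>xs. Suc (f xs))"
proof (rule computable_compose1[OF _ assms])
  show "computable Ora 1 (\<lambda>xs. Suc (xs ! 0))"
    unfolding computable_def
  proof (intro exI[of _ Succ] allI impI)
    fix xs :: "nat list" assume "length xs = 1"
    then obtain x where "xs = [x]" by (auto simp: length_Suc_conv)
    then show "ev Ora Succ xs (Suc (xs ! 0))" by (auto intro: ev_succ)
  qed
qed

lemma computable_const: "computable Ora k (\<lambda>xs. c)"
proof (induction c)
  case 0
  show ?case unfolding computable_def by (rule exI[of _ Zero]) (auto intro: ev_zero)
qed (rule computable_Suc)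

lemma rel_computable_oracle:
  assumes "computable Ora k f"
  shows "rel_computable Ora k (\<lambda>xs. Ora (f xs))"
  unfolding rel_computable_iff
proof (rule computable_compose1[OF _ assms])
  show "computable Ora 1 (\<lambda>xs. if Ora (xs ! 0) then 1 else 0)"
    unfolding computable_def
  proof (intro exI[of _ Orc] allI impI)
    fix xs :: "nat list" assume "length xs = 1"
    then obtain x where "xs = [x]" by (auto simp: length_Suc_conv)
    then show "ev Ora Orc xs (if Ora (xs ! 0) then 1 else 0)"
      using ev_orc[of Ora x "[]"] by simp
  qed
qed

text \<open>\<open>F\<close> is characterized by its recursion equations, so the rule applies
  directly to existing functions such as \<open>triangle\<close>, \<open>suffix\<close> and
  \<open>walk\<close>. There is exactly one parameter \<open>y\<close>; recursions without a
  parameter pass a dummy.\<close>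

lemma computable_prim_rec:
  assumes zero: "\<And>y. F 0 y = f y" and Suc: "\<And>n y. F (Suc n) y = g n (F n y) y"
    and f: "computable Ora 1 (\<lambda>xs. f (xs ! 0))"
    and g: "computable Ora 3 (\<lambda>xs. g (xs ! 0) (xs ! 1) (xs ! 2))"
    and h: "computable Ora k h" and h': "computable Ora k h'"
  shows "computable Ora k (\<lambda>xs. F (h xs) (h' xs))"
proof (rule computable_compose2[OF _ h h'])
  obtain c where c: "\<And>xs. length xs = 1 \<Longrightarrow> ev Ora c xs (f (xs ! 0))"
    using f by (auto simp: computable_def)
  obtain d where d: "\<And>xs. length xs = 3 \<Longrightarrow> ev Ora d xs (g (xs ! 0) (xs ! 1) (xs ! 2))"
    using g by (auto simp: computable_def)
  have *: "ev Ora (Prim c d) [n, y] (F n y)" for n y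
  proof (induction n)
    case 0
    then show ?case using c[of "[y]"] by (auto intro: ev_prim0 simp: zero)
  next
    case (Suc n)
    then show ?case using d[of "[n, F n y, y]"] by (auto intro: ev_primS simp: assms(2))
  qed
  show "computable Ora 2 (\<lambda>xs. F (xs ! 0) (xs ! 1))"
    unfolding computable_def
  proof (intro exI[of _ "Prim c d"] allI impI)
    fix xs :: "nat list" assume "length xs = 2"
    then obtain n y where "xs = [n, y]" by (auto simp: length_Suc_conv numeral_2_eq_2)
    then show "ev Ora (Prim c d) xs (F (xs ! 0) (xs ! 1))" using * by simp
  qed
qed

section \<open>Arithmetic, case distinction and decidable relations\<close>

lemma computable_pred:
  assumes "computable Ora k f"
  shows "computable Ora k (\<lambda>xs. f xs - 1)"
  by (rule computable_prim_rec[where F = "\<lambda>n y. n - 1" and f = "\<lambda>y. 0" and g = "\<lambda>n z y. n"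
        and h' = "\<lambda>xs. 0"])
    (intro computable_const computable_proj assms | simp)+

lemma computable_add:
  assumes "computable Ora k f" "computable Ora k g"
  shows "computable Ora k (\<lambda>xs. f xs + g xs)"
  by (rule computable_prim_rec[where F = "(+)" and f = "\<lambda>y. y" and g = "\<lambda>n z y. Suc z"])
    (intro computable_Suc computable_proj assms | simp)+

lemma computable_diff:
  assumes "computable Ora k f" "computable Ora k g"
  shows "computable Ora k (\<lambda>xs. f xs - g xs)"
  by (rule computable_prim_rec[where F = "\<lambda>n y. y - n" and f = "\<lambda>y. y" and g = "\<lambda>n z y. z - 1"])
    (intro computable_pred computable_proj assms | simp)+

lemma computable_mult:
  assumes "computable Ora k f" "computable Ora k g"
  shows "computable Ora k (\<lambda>xs. f xs * g xs)"
  by (rule computable_prim_rec[where F = "(*)" and f = "\<lambda>y. 0" and g = "\<lambda>n z y. y + z"])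
    (intro computable_add computable_const computable_proj assms | simp)+

text \<open>Both branches are total, so with \<open>p\<close> the characteristic function of
  \<open>P\<close> the case distinction is the arithmetic expression
  \<open>p * f + (1 - p) * g\<close>.\<close>

lemma computable_if:
  assumes "rel_computable Ora k P" "computable Ora k f" "computable Ora k g"
  shows "computable Ora k (\<lambda>xs. if P xs then f xs else g xs)"
proof -
  let ?p = "\<lambda>xs. if P xs then 1 else 0 :: nat"
  have "computable Ora k (\<lambda>xs. ?p xs * f xs + (1 - ?p xs) * g xs)"
    using assms(1) unfolding rel_computable_iff
    by (intro computable_add computable_mult computable_diff computable_const assms(2,3))
  then show ?thesis by (rule computable_cong) simp
qed

lemma rel_computable_const: "rel_computable Ora k (\<lambda>xs. b)"
  unfolding rel_computable_iff by (rule computable_const)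

lemma rel_computable_not:
  assumes "rel_computable Ora k P"
  shows "rel_computable Ora k (\<lambda>xs. \<not> P xs)"
  using computable_if[OF assms computable_const[where c = 0] computable_const[where c = 1]]
  unfolding rel_computable_iff by (rule computable_cong) simp

lemma rel_computable_conj:
  assumes "rel_computable Ora k P" "rel_computable Ora k Q"
  shows "rel_computable Ora k (\<lambda>xs. P xs \<and> Q xs)"
  using computable_if[OF assms(1) assms(2)[unfolded rel_computable_iff]
      computable_const[where c = 0]]
  unfolding rel_computable_iff by (rule computable_cong) simp

lemma rel_computable_disj:
  assumes "rel_computable Ora k P" "rel_computable Ora k Q"
  shows "rel_computable Ora k (\<lambda>xs. P xs \<or> Q xs)"
  using rel_computable_not[OF rel_computable_conj[OF assms[THEN rel_computable_not]]] by simp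

lemma rel_computable_imp:
  assumes "rel_computable Ora k P" "rel_computable Ora k Q"
  shows "rel_computable Ora k (\<lambda>xs. P xs \<longrightarrow> Q xs)"
  using rel_computable_disj[OF rel_computable_not[OF assms(1)] assms(2)] by simp

lemma rel_computable_le:
  assumes "computable Ora k f" "computable Ora k g"
  shows "rel_computable Ora k (\<lambda>xs. f xs \<le> g xs)"
proof -
  have "computable Ora k (\<lambda>xs. 1 - (f xs - g xs))"
    by (intro computable_diff computable_const assms)
  then show ?thesis unfolding rel_computable_iff by (rule computable_cong) auto
qed

lemma rel_computable_less:
  assumes "computable Ora k f" "computable Ora k g"
  shows "rel_computable Ora k (\<lambda>xs. f xs < g xs)"
  using rel_computable_le[OF computable_Suc[OF assms(1)] assms(2)] by (simp add: Suc_le_eq)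

lemma rel_computable_eq:
  assumes "computable Ora k f" "computable Ora k g"
  shows "rel_computable Ora k (\<lambda>xs. f xs = g xs)"
  using rel_computable_conj[OF rel_computable_le[OF assms] rel_computable_le[OF assms(2,1)]]
  by (simp only: order_eq_iff[symmetric])

text \<open>The elements of \<open>A\<close> are built into the program as constants, so no
  effective description of \<open>A\<close> is required. This later makes the scarce classes and
  their table of images usable.\<close>

lemma rel_computable_finite:
  assumes "finite A" "computable Ora k f"
  shows "rel_computable Ora k (\<lambda>xs. f xs \<in> A)"
  using assms(1)
proof induction
  case empty
  show ?case by (simp add: rel_computable_const)
next
  case (insert a A)
  then show ?case
    using rel_computable_disj[OF rel_computable_eq[OF assms(2) computable_const[where c = a]] insert.IH] by simp
qed

text \<open>\<open>Mn\<close> stops at the first value 0, so it is run on the characteristic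
  function of the negation of \<open>P\<close>. The existence assumption makes the search
  total.\<close>

lemma computable_Least:
  assumes P: "rel_computable Ora 2 (\<lambda>xs. P (xs ! 0) (xs ! 1))" and ex: "\<And>y. \<exists>n. P n y"
    and f: "computable Ora k f"
  shows "computable Ora k (\<lambda>xs. LEAST n. P n (f xs))"
proof (rule computable_compose1[OF _ f])
  obtain c where c: "\<And>xs. length xs = 2 \<Longrightarrow> ev Ora c xs (if \<not> P (xs ! 0) (xs ! 1) then 1 else 0)"
    using rel_computable_not[OF P] unfolding rel_computable_def by blast
  have "ev Ora (Mn c) [y] (LEAST n. P n y)" for y
  proof (rule ev_mn)
    show "ev Ora c [LEAST n. P n y, y] 0"
      using c[of "[LEAST n. P n y, y]"] LeastI_ex[OF ex[of y]] by simp
    show "\<forall>m<LEAST n. P n y. \<exists>z>0. ev Ora c [m, y] z"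
    proof (intro allI impI)
      fix m assume "m < (LEAST n. P n y)"
      then have "\<not> P m y" by (rule not_less_Least)
      then show "\<exists>z>0. ev Ora c [m, y] z" using c[of "[m, y]"] by auto
    qed
  qed
  then show "computable Ora 1 (\<lambda>xs. LEAST n. P n (xs ! 0))"
    unfolding computable_def by (intro exI[of _ "Mn c"]) (auto simp: length_Suc_conv)
qed

section \<open>The Cantor pairing function and its inverse\<close>

lemma computable_triangle:
  assumes "computable Ora k f"
  shows "computable Ora k (\<lambda>xs. triangle (f xs))"
  by (rule computable_prim_rec[where F = "\<lambda>n y. triangle n" and f = "\<lambda>y. 0"
        and g = "\<lambda>n z y. z + Suc n" and h' = f])
    (intro computable_add computable_Suc computable_const computable_proj assms | simp)+

lemma computable_prod_encode:
  assumes "computable Ora k f" "computable Ora k g"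
  shows "computable Ora k (\<lambda>xs. prod_encode (f xs, g xs))"
  unfolding prod_encode_def prod.case by (intro computable_add computable_triangle assms)

definition pfst :: "nat \<Rightarrow> nat" where "pfst n = fst (prod_decode n)"
definition psnd :: "nat \<Rightarrow> nat" where "psnd n = snd (prod_decode n)"

lemma pfst_encode [simp]: "pfst (prod_encode (x, y)) = x"
  and psnd_encode [simp]: "psnd (prod_encode (x, y)) = y"
  and encode_pfst_psnd [simp]: "prod_encode (pfst n, psnd n) = n"
  by (simp_all add: pfst_def psnd_def)

text \<open>The code of \<open>(x, y)\<close> is \<open>triangle (x + y) + x\<close>, which lies
  below the next triangular number. The diagonal \<open>x + y\<close> is therefore found by search,
  and both components follow by subtraction.\<close>

lemma pfst_psnd_sum: "pfst n + psnd n = (LEAST k. n < triangle (Suc k))"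
proof (rule Least_equality[symmetric])
  define x y where "x = pfst n" and "y = psnd n"
  have n: "n = triangle (x + y) + x"
    using encode_pfst_psnd[of n] by (simp add: x_def y_def prod_encode_def)
  show "n < triangle (Suc (x + y))" by (simp add: n)
  fix k assume k: "n < triangle (Suc k)"
  have mono: "mono triangle" by (rule mono_iff_le_Suc[THEN iffD2]) simp
  show "x + y \<le> k"
  proof (rule ccontr)
    assume "\<not> x + y \<le> k"
    then have "triangle (Suc k) \<le> triangle (x + y)" by (intro monoD[OF mono]) simp
    with k n show False by linarith
  qed
qed

lemma computable_pfst_psnd_sum:
  assumes "computable Ora k f"
  shows "computable Ora k (\<lambda>xs. pfst (f xs) + psnd (f xs))"
proof -
  have "n < triangle (Suc n)" for n by (induction n) auto
  then have "\<exists>m. n < triangle (Suc m)" for n by blast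
  then show ?thesis unfolding pfst_psnd_sum
    by (intro computable_Least[OF _ _ assms] rel_computable_less computable_triangle computable_Suc
        computable_proj) auto
qed

lemma computable_pfst:
  assumes "computable Ora k f"
  shows "computable Ora k (\<lambda>xs. pfst (f xs))"
proof -
  have "computable Ora k (\<lambda>xs. f xs - triangle (pfst (f xs) + psnd (f xs)))"
    by (intro computable_diff computable_triangle computable_pfst_psnd_sum assms)
  moreover have "n - triangle (pfst n + psnd n) = pfst n" for n
    using encode_pfst_psnd[of n] by (simp only: prod_encode_def prod.case)
  ultimately show ?thesis by simp
qed

lemma computable_psnd:
  assumes "computable Ora k f"
  shows "computable Ora k (\<lambda>xs. psnd (f xs))"
  using computable_diff[OF computable_pfst_psnd_sum[OF assms] computable_pfst[OF assms]] by simp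

lemmas computable_intros =
  rel_computable_const rel_computable_not rel_computable_conj rel_computable_disj rel_computable_imp
  rel_computable_le rel_computable_less rel_computable_eq
  computable_const computable_Suc computable_pred computable_add computable_if
  computable_prod_encode computable_pfst computable_psnd

section \<open>Functions with a \<open>\<Sigma>\<^sub>3\<close> graph\<close>

text \<open>As \<open>f\<close> is total, \<open>f x \<noteq> z\<close> holds iff some value other
  than \<open>z\<close> is taken at \<open>x\<close>. Pairing this value with the outer witness
  \<open>a\<close> keeps the complement of the graph in \<Sigma>3 form.\<close>

lemma Delta3_funI:
  assumes R: "rel_computable Ora 5 (\<lambda>xs. R (xs ! 0) (xs ! 1) (xs ! 2) (xs ! 3) (xs ! 4))"
    and f: "\<And>x z. f x = z \<longleftrightarrow> (\<exists>a. \<forall>b. \<exists>c. R x z a b c)"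
  shows "Delta3_fun Ora f"
proof -
  let ?G = "{prod_encode (x, f x) | x. True}"
  have comp: "rel_computable Ora 4 (\<lambda>xs. R (f1 xs) (f2 xs) (f3 xs) (f4 xs) (f5 xs))"
    if "computable Ora 4 f1" "computable Ora 4 f2" "computable Ora 4 f3" "computable Ora 4 f4"
      "computable Ora 4 f5" for f1 f2 f3 f4 f5
    using computable_compose[OF R[unfolded rel_computable_iff], of "[f1, f2, f3, f4, f5]" 4] that
    unfolding rel_computable_iff by auto
  have G: "n \<in> ?G \<longleftrightarrow> f (pfst n) = psnd n" for n
  proof
    assume "f (pfst n) = psnd n"
    then have "n = prod_encode (pfst n, f (pfst n))" by simp
    then show "n \<in> ?G" by blast
  qed auto
  have "n \<in> ?G \<longleftrightarrow> (\<exists>a. \<forall>b. \<exists>c. R (pfst n) (psnd n) a b c)" for n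
    unfolding G by (rule f)
  moreover have "rel_computable Ora 4
      (\<lambda>xs. R (pfst (xs ! 0)) (psnd (xs ! 0)) (xs ! 1) (xs ! 2) (xs ! 3))"
    by (intro comp computable_pfst computable_psnd computable_proj) simp_all
  ultimately have "Sigma3 Ora ?G"
    unfolding Sigma3_def
    by (intro exI[of _ "\<lambda>xs. R (pfst (xs ! 0)) (psnd (xs ! 0)) (xs ! 1) (xs ! 2) (xs ! 3)"]) simp
  moreover have "n \<in> - ?G \<longleftrightarrow>
      (\<exists>a. \<forall>b. \<exists>c. pfst a \<noteq> psnd n \<and> R (pfst n) (pfst a) (psnd a) b c)" for n
  proof -
    have "n \<in> - ?G \<longleftrightarrow> (\<exists>z. z \<noteq> psnd n \<and> f (pfst n) = z)" using G by simp
    also have "\<dots> \<longleftrightarrow> (\<exists>z a. z \<noteq> psnd n \<and> (\<forall>b. \<exists>c. R (pfst n) z a b c))" unfolding f by blast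
    also have "\<dots> \<longleftrightarrow> (\<exists>a. \<forall>b. \<exists>c. pfst a \<noteq> psnd n \<and> R (pfst n) (pfst a) (psnd a) b c)"
      by (metis pfst_encode psnd_encode)
    finally show ?thesis .
  qed
  moreover have "rel_computable Ora 4 (\<lambda>xs. pfst (xs ! 1) \<noteq> psnd (xs ! 0) \<and>
      R (pfst (xs ! 0)) (pfst (xs ! 1)) (psnd (xs ! 1)) (xs ! 2) (xs ! 3))"
    by (intro rel_computable_conj rel_computable_not rel_computable_eq comp computable_pfst
        computable_psnd computable_proj) simp_all
  ultimately have "Sigma3 Ora (- ?G)"
    unfolding Sigma3_def
    by (intro exI[of _ "\<lambda>xs. pfst (xs ! 1) \<noteq> psnd (xs ! 0) \<and>
          R (pfst (xs ! 0)) (pfst (xs ! 1)) (psnd (xs ! 1)) (xs ! 2) (xs ! 3)"]) simp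
  with \<open>Sigma3 Ora ?G\<close> show ?thesis unfolding Delta3_fun_def Delta3_def by blast
qed

section \<open>Coded sequences\<close>

text \<open>Every number is read as an infinite sequence by iterated unpairing. No length is stored;
  a user consults only as many entries as are relevant.\<close>

primrec suffix :: "nat \<Rightarrow> nat \<Rightarrow> nat" where
  "suffix s 0 = s"
| "suffix s (Suc i) = psnd (suffix s i)"

definition entry :: "nat \<Rightarrow> nat \<Rightarrow> nat" where "entry s i = pfst (suffix s i)"

lemma suffix_Suc_shift: "suffix s (Suc i) = suffix (psnd s) i"
  by (induction i) auto

lemma ex_entries: "\<exists>s. \<forall>i<n. entry s i = w i"
proof (induction n arbitrary: w)
  case (Suc n)
  obtain s where s: "\<forall>i<n. entry s i = w (Suc i)"
    using Suc.IH[of "\<lambda>i. w (Suc i)"] by blast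
  have "entry (prod_encode (w 0, s)) i = w i" if "i < Suc n" for i
  proof (cases i)
    case 0
    then show ?thesis by (simp add: entry_def)
  next
    case (Suc j)
    then have "entry (prod_encode (w 0, s)) i = entry s j"
      by (simp only: entry_def suffix_Suc_shift psnd_encode)
    then show ?thesis using s that Suc by simp
  qed
  then show ?case by blast
qed simp

lemma computable_entry:
  assumes "computable Ora k f" "computable Ora k g"
  shows "computable Ora k (\<lambda>xs. entry (f xs) (g xs))"
  unfolding entry_def
  by (rule computable_pfst, rule computable_prim_rec[where F = "\<lambda>n s. suffix s n"
        and f = "\<lambda>y. y" and g = "\<lambda>n z y. psnd z"])
    (intro computable_psnd computable_proj assms | simp)+

section \<open>Sizes of equivalence classes\<close>

text \<open>This serves two purposes: as \<open>u\<close> grows it approximates the size of the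
  class of \<open>x\<close> from below, and for \<open>u\<close> in that class it is the position of
  \<open>u\<close> in increasing order.\<close>

definition cnt :: "(nat \<times> nat) set \<Rightarrow> nat \<Rightarrow> nat \<Rightarrow> nat" where
  "cnt E x u = card {t. t < u \<and> (x, t) \<in> E}"

text \<open>The comparison of class sizes, written so that its \<Pi>2 form over a decidable matrix
  is visible.\<close>

definition class_le :: "(nat \<times> nat) set \<Rightarrow> (nat \<times> nat) set \<Rightarrow> nat \<Rightarrow> nat \<Rightarrow> bool" where
  "class_le E F x y \<longleftrightarrow> (\<forall>u. \<exists>v. cnt E x u \<le> cnt F y v)"

definition class_size :: "(nat \<times> nat) set \<Rightarrow> nat \<Rightarrow> enat" where
  "class_size E x = (SUP u. enat (cnt E x u))"

text \<open>A class is represented by its least element; phrasing this through \<open>cnt\<close>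
  makes it decidable from \<open>E\<close>.\<close>

definition rep :: "(nat \<times> nat) set \<Rightarrow> nat \<Rightarrow> bool" where
  "rep E x \<longleftrightarrow> (x, x) \<in> E \<and> cnt E x x = 0"

lemma cnt_0 [simp]: "cnt E x 0 = 0"
  by (simp add: cnt_def)

lemma cnt_Suc: "cnt E x (Suc u) = cnt E x u + (if (x, u) \<in> E then 1 else 0)"
proof -
  have "{t. t < Suc u \<and> (x, t) \<in> E} =
      (if (x, u) \<in> E then insert u {t. t < u \<and> (x, t) \<in> E} else {t. t < u \<and> (x, t) \<in> E})"
    by (auto simp: less_Suc_eq)
  then show ?thesis by (simp add: cnt_def)
qed

lemma cnt_mono: "u \<le> v \<Longrightarrow> cnt E x u \<le> cnt E x v"
  unfolding cnt_def by (rule card_mono) auto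

lemma cnt_strict: "(x, u) \<in> E \<Longrightarrow> u < v \<Longrightarrow> cnt E x u < cnt E x v"
  using cnt_mono[of "Suc u" v E x] by (simp add: cnt_Suc)

lemma cnt_inj: "(x, u) \<in> E \<Longrightarrow> (x, v) \<in> E \<Longrightarrow> cnt E x u = cnt E x v \<Longrightarrow> u = v"
  using cnt_strict[of x u E v] cnt_strict[of x v E u] by (cases u v rule: linorder_cases) auto

text \<open>The count starts at 0 and grows by at most one per step, and only at elements of the
  class, so it leaves the value \<open>n\<close> at such an element.\<close>

lemma ex_cnt_eq: "n < cnt E x v \<Longrightarrow> \<exists>z. (x, z) \<in> E \<and> cnt E x z = n"
proof (induction v)
  case (Suc v)
  then show ?case by (cases "n < cnt E x v") (auto simp: cnt_Suc split: if_splits)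
qed simp

text \<open>For \<open>n = Suc m\<close>, being at most a supremum in \<open>enat\<close> means that
  \<open>m\<close> is strictly below it, and a strict bound is already witnessed by one term. The
  order on \<open>enat\<close> makes transitivity and least sizes available.\<close>

lemma class_le_iff_size: "class_le E F x y \<longleftrightarrow> class_size E x \<le> class_size F y"
proof -
  have "(\<exists>v. n \<le> cnt F y v) \<longleftrightarrow> enat n \<le> class_size F y" for n
  proof (cases n)
    case 0
    then show ?thesis by (simp add: zero_enat_def[symmetric])
  next
    case (Suc m)
    have "(\<exists>v. n \<le> cnt F y v) \<longleftrightarrow> enat m < class_size F y"
      unfolding class_size_def less_SUP_iff by (simp add: Suc Suc_le_eq)
    also have "\<dots> \<longleftrightarrow> enat n \<le> class_size F y"
      using Suc_ile_eq[of m "class_size F y"] by (simp add: Suc)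
    finally show ?thesis .
  qed
  then show ?thesis by (simp add: class_le_def class_size_def[of E] SUP_le_iff)
qed

lemma rep_exists:
  assumes "equiv U E" "x \<in> U"
  shows "\<exists>r. rep E r \<and> (r, x) \<in> E"
proof -
  define r where "r = (LEAST t. (t, x) \<in> E)"
  have "(x, x) \<in> E" using assms by (meson equivE refl_onD)
  then have r: "(r, x) \<in> E" unfolding r_def by (rule LeastI)
  have "\<not> (t < r \<and> (r, t) \<in> E)" for t
  proof
    assume t: "t < r \<and> (r, t) \<in> E"
    then have "(t, x) \<in> E" using assms(1) r by (meson equivE symD transD)
    then show False using t not_less_Least unfolding r_def by blast
  qed
  then have "cnt E r r = 0" by (simp add: cnt_def)
  moreover have "(r, r) \<in> E" using assms(1) r by (meson equivE symD transD)
  ultimately show ?thesis using r by (auto simp: rep_def)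
qed

lemma rep_unique:
  assumes "equiv U E" "rep E r" "rep E r'" "(r, r') \<in> E"
  shows "r = r'"
proof -
  have "(r', r) \<in> E" using assms(1,4) by (meson equivE symD)
  then show ?thesis
    using assms(2-4) cnt_strict[of r' r E r'] cnt_strict[of r r' E r]
    by (cases r r' rule: linorder_cases) (simp_all add: rep_def)
qed

lemma computable_cnt:
  assumes "rel_computable Ora 2 (\<lambda>xs. (xs ! 0, xs ! 1) \<in> E)"
    "computable Ora k f" "computable Ora k g"
  shows "computable Ora k (\<lambda>xs. cnt E (f xs) (g xs))"
proof (rule computable_prim_rec[where F = "\<lambda>u x. cnt E x u" and f = "\<lambda>x. 0"
      and g = "\<lambda>u z x. z + (if (x, u) \<in> E then 1 else 0)"])
  show "computable Ora 3 (\<lambda>xs. xs ! 1 + (if (xs ! 2, xs ! 0) \<in> E then 1 else 0))"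
    by (intro computable_add computable_proj
        computable_compose2[OF assms(1)[unfolded rel_computable_iff]]) simp_all
qed (simp_all add: cnt_Suc computable_const assms)

section \<open>Serving requests one at a time\<close>

text \<open>Time \<open>i\<close> is offered to the pending request \<open>walk N S i\<close>, which stays pending only if it
  is needed (\<open>N\<close>) and the offer does not suit it (\<open>S\<close>).\<close>

primrec walk :: "(nat \<Rightarrow> bool) \<Rightarrow> (nat \<Rightarrow> nat \<Rightarrow> bool) \<Rightarrow> nat \<Rightarrow> nat" where
  "walk N S 0 = 0"
| "walk N S (Suc i) =
    (if N (walk N S i) \<and> \<not> S (walk N S i) i then walk N S i else Suc (walk N S i))"

lemma walk_mono: "i \<le> j \<Longrightarrow> walk N S i \<le> walk N S j"
  by (rule lift_Suc_mono_le[of "walk N S"]) auto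

lemma walk_leaves_unique:
  assumes "walk N S i = x" "walk N S (Suc i) = Suc x" "walk N S j = x" "walk N S (Suc j) = Suc x"
  shows "i = j"
  using assms walk_mono[of "Suc i" j N S] walk_mono[of "Suc j" i N S]
  by (cases i j rule: linorder_cases) (auto simp del: walk.simps)

lemma walk_leaves:
  assumes "\<And>x. N x \<Longrightarrow> infinite {i. S x i}"
  shows "\<exists>i. walk N S i = x \<and> walk N S (Suc i) = Suc x"
proof -
  have leave: "\<exists>i. walk N S i = x \<and> walk N S (Suc i) = Suc x" if i: "walk N S i = x" for i x
  proof (rule ccontr)
    assume stuck: "\<nexists>i. walk N S i = x \<and> walk N S (Suc i) = Suc x"
    have wait: "N x \<and> \<not> S x j" if "walk N S j = x" for j
      using that stuck by (metis walk.simps(2))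
    have "walk N S j = x" if "i \<le> j" for j
      using that
    proof (induction j rule: dec_induct)
      case base
      show ?case by (rule i)
    next
      case (step j)
      then show ?case using wait[of j] by simp
    qed
    then have *: "N x \<and> \<not> S x j" if "i \<le> j" for j
      using that wait by blast
    then have "{i. S x i} \<subseteq> {..<i}" by (auto simp: not_le[symmetric])
    then show False using assms[of x] *[of i] finite_subset by blast
  qed
  have "\<exists>i. walk N S i = x"
  proof (induction x)
    case 0
    show ?case by (rule exI[of _ 0]) simp
  next
    case (Suc x)
    then show ?case using leave by blast
  qed
  then show ?thesis using leave by blast
qed

text \<open>Agreement is demanded only at the pairs the run actually meets, so a list with one
  answer per time can replace the full relation \<open>S\<close>.\<close>

lemma walk_cong:
  assumes "\<And>j. j < i \<Longrightarrow> S (walk N S j) j \<longleftrightarrow> S' (walk N S j) j"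
  shows "walk N S i = walk N S' i"
  using assms
proof (induction i)
  case (Suc i)
  then have "walk N S i = walk N S' i" by simp
  then show ?case using Suc.prems[of i] by simp
qed simp

text \<open>Suitability depends here on a parameter and the time, but not on the pending request:
  this is the shape of a run that looks its answers up in a code.\<close>

lemma computable_walk:
  assumes N: "rel_computable Ora 1 (\<lambda>xs. N (xs ! 0))"
    and S: "rel_computable Ora 2 (\<lambda>xs. S (xs ! 0) (xs ! 1))"
    and "computable Ora k f" "computable Ora k g"
  shows "computable Ora k (\<lambda>xs. walk N (\<lambda>x. S (f xs)) (g xs))"
proof (rule computable_prim_rec[where F = "\<lambda>n s. walk N (\<lambda>x. S s) n" and f = "\<lambda>s. 0"
      and g = "\<lambda>n z s. if N z \<and> \<not> S s n then z else Suc z"])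
  have "rel_computable Ora 3 (\<lambda>xs. N (xs ! 1))" "rel_computable Ora 3 (\<lambda>xs. S (xs ! 2) (xs ! 0))"
    using computable_compose1[OF N[unfolded rel_computable_iff] computable_proj[of 1 3]]
      computable_compose2[OF S[unfolded rel_computable_iff] computable_proj[of 2 3]
        computable_proj[of 0 3]]
    by (simp_all add: rel_computable_iff)
  then show "computable Ora 3 (\<lambda>xs. if N (xs ! 1) \<and> \<not> S (xs ! 2) (xs ! 0) then xs ! 1 else Suc (xs ! 1))"
    by (intro computable_intros computable_proj) simp_all
qed (simp_all add: computable_const assms)

section \<open>Matching the classes\<close>

text \<open>Let \<open>q x\<close> represent the class that contains \<open>f x\<close>. Since
  \<open>f\<close> reflects the relation, different classes go to different classes; since
  \<open>f\<close> is injective, finite parts of a class have images of the same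
  cardinality.\<close>

lemma embedding_on_reps:
  assumes E: "equiv U E" and F: "equiv V F" and f: "is_embedding U E V F f"
  shows "\<exists>q. inj_on q {x. rep E x} \<and> (\<forall>x. rep E x \<longrightarrow> rep F (q x) \<and> class_le E F x (q x))"
proof -
  have EU: "E \<subseteq> U \<times> U" using E by (auto elim: equivE)
  have fV: "f x \<in> V" and fE: "(x, y) \<in> E \<longleftrightarrow> (f x, f y) \<in> F" and finj: "inj_on f U"
    if "x \<in> U" "y \<in> U" for x y
    using f that by (auto simp: is_embedding_def)
  have repU: "x \<in> U" if "rep E x" for x using that EU by (auto simp: rep_def)
  have "\<forall>x. \<exists>r. x \<in> U \<longrightarrow> rep F r \<and> (r, f x) \<in> F"
    using rep_exists[OF F] fV by blast
  then obtain q where q: "\<And>x. x \<in> U \<Longrightarrow> rep F (q x) \<and> (q x, f x) \<in> F" by metis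
  have "inj_on q {x. rep E x}"
  proof (rule inj_onI)
    fix x y assume "x \<in> {x. rep E x}" "y \<in> {x. rep E x}" and eq: "q x = q y"
    then have xy: "rep E x" "rep E y" "x \<in> U" "y \<in> U" using repU by auto
    have "(q x, f x) \<in> F" "(q x, f y) \<in> F" using q[of x] q[of y] xy eq by auto
    then have "(f x, f y) \<in> F" using F by (meson equivE symD transD)
    then show "x = y" using rep_unique[OF E xy(1,2)] fE xy by blast
  qed
  moreover have "class_le E F x (q x)" if "rep E x" for x
    unfolding class_le_def
  proof
    fix u
    let ?A = "{t. t < u \<and> (x, t) \<in> E}"
    have x: "x \<in> U" and A: "?A \<subseteq> U" using repU that EU by auto
    have "finite (f ` ?A)" by simp
    \<comment> \<open>\<open>v\<close> bounds the images of the finitely many class members below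
      \<open>u\<close>, so the count up to \<open>v\<close> sees all of them.\<close>
    then obtain v where v: "\<And>t. t \<in> f ` ?A \<Longrightarrow> t < v"
      by (metis finite_nat_set_iff_bounded)
    have "(q x, f t) \<in> F" if "t \<in> ?A" for t
    proof -
      have "(f x, f t) \<in> F" using fE[OF x] A that by blast
      then show ?thesis using q[OF x] F by (meson equivE transD)
    qed
    then have "f ` ?A \<subseteq> {t. t < v \<and> (q x, t) \<in> F}" using v by auto
    then have "card (f ` ?A) \<le> cnt F (q x) v" unfolding cnt_def by (intro card_mono) auto
    moreover have "card (f ` ?A) = cnt E x u"
      unfolding cnt_def by (rule card_image) (use finj[OF x x] A inj_on_subset in blast)
    ultimately show "\<exists>v. cnt E x u \<le> cnt F (q x) v" by metis
  qed
  ultimately show ?thesis using q repU by blast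
qed

text \<open>The map \<open>q\<close> may be arbitrarily complicated; the construction consults it
  only on the finitely many scarce representatives.\<close>

locale class_matching =
  fixes U E V F q
  assumes E: "equiv U E" and F: "equiv V F"
    and q_inj: "inj_on q {x. rep E x}"
    and q: "\<And>x. rep E x \<Longrightarrow> rep F (q x) \<and> class_le E F x (q x)"
begin

definition scarce :: "nat set" where
  "scarce = {x. rep E x \<and> finite {y. rep F y \<and> class_le E F x y}}"

lemma finite_scarce: "finite scarce"
proof (cases "scarce = {}")
  case False
  \<comment> \<open>A smallest scarce class exists because \<open>enat\<close> is well-ordered. All
    scarce classes are then mapped by \<open>q\<close> into the finite set belonging to
    \<open>m\<close>.\<close>
  then obtain m where m: "m \<in> scarce" "\<And>x. x \<in> scarce \<Longrightarrow> class_size E m \<le> class_size E x"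
    using exists_least_iff[of "\<lambda>n. \<exists>x\<in>scarce. class_size E x = n"]
    by (metis ex_in_conv linorder_not_less)
  have "q ` scarce \<subseteq> {y. rep F y \<and> class_le E F m y}"
  proof (rule image_subsetI)
    fix x assume x: "x \<in> scarce"
    then have "rep F (q x)" "class_size E x \<le> class_size F (q x)"
      using q by (auto simp: scarce_def class_le_iff_size)
    then show "q x \<in> {y. rep F y \<and> class_le E F m y}"
      using m(2)[OF x] by (simp add: class_le_iff_size)
  qed
  moreover have "finite {y. rep F y \<and> class_le E F m y}" using m(1) by (simp add: scarce_def)
  ultimately have "finite (q ` scarce)" by (rule finite_subset)
  then show ?thesis
    by (rule finite_imageD) (rule inj_on_subset[OF q_inj], auto simp: scarce_def)
qed simp

section \<open>Greedy matching of the classes that are not scarce\<close>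

definition needed :: "nat \<Rightarrow> bool" where "needed x \<longleftrightarrow> rep E x \<and> x \<notin> scarce"
definition free :: "nat \<Rightarrow> bool" where "free y \<longleftrightarrow> rep F y \<and> y \<notin> q ` scarce"

text \<open>The time doubles as the candidate on offer, so each \<open>y\<close> is offered exactly
  once and cannot be given to two requests.\<close>

abbreviation greedy :: "nat \<Rightarrow> nat" where
  "greedy \<equiv> walk needed (\<lambda>x y. free y \<and> class_le E F x y)"

text \<open>The step from \<open>x\<close> to \<open>Suc x\<close> at time \<open>y\<close> records
  that \<open>y\<close> was accepted; requiring \<open>needed x\<close> discards the steps that
  merely skip a number.\<close>

definition target :: "nat \<Rightarrow> nat \<Rightarrow> bool" where
  "target x y \<longleftrightarrow> x \<in> scarce \<and> y = q x \<or> needed x \<and> greedy y = x \<and> greedy (Suc y) = Suc x"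

lemma target_exists:
  assumes "rep E x"
  shows "\<exists>y. target x y"
proof (cases "x \<in> scarce")
  case False
  have "infinite {y. free y \<and> class_le E F x y}" if "needed x" for x
  proof
    assume "finite {y. free y \<and> class_le E F x y}"
    then have "finite ({y. free y \<and> class_le E F x y} \<union> q ` scarce)" using finite_scarce by simp
    then have "finite {y. rep F y \<and> class_le E F x y}"
      by (rule rev_finite_subset) (auto simp: free_def)
    with that show False by (simp add: needed_def scarce_def)
  qed
  then have "\<exists>y. greedy y = x \<and> greedy (Suc y) = Suc x" by (rule walk_leaves)
  then show ?thesis using assms False unfolding target_def needed_def by blast
qed (auto simp: target_def)

lemma target_unique:
  assumes "target x y" "target x y'"
  shows "y = y'"
proof (cases "x \<in> scarce")
  case True
  then show ?thesis using assms by (simp add: target_def needed_def)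
next
  case False
  then have "greedy y = x" "greedy (Suc y) = Suc x" "greedy y' = x" "greedy (Suc y') = Suc x"
    using assms by (simp_all add: target_def del: walk.simps)
  then show ?thesis by (rule walk_leaves_unique)
qed

lemma greedy_free:
  assumes "needed x" "greedy y = x" "greedy (Suc y) = Suc x"
  shows "free y \<and> class_le E F x y"
  using assms by (simp split: if_splits)

lemma target_rep: "target x y \<Longrightarrow> rep F y \<and> class_le E F x y"
proof (cases "x \<in> scarce")
  case True
  then show "target x y \<Longrightarrow> rep F y \<and> class_le E F x y"
    using q[of x] by (simp add: target_def needed_def scarce_def)
next
  case False
  then show "target x y \<Longrightarrow> rep F y \<and> class_le E F x y"
    using greedy_free[of x y] by (simp add: target_def free_def del: walk.simps)
qed

text \<open>Scarce classes receive reserved representatives and the others receive free ones, so the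
  two cases cannot collide. Within the first, \<open>q\<close> is injective; within the second,
  \<open>x\<close> is determined as \<open>greedy y\<close>.\<close>

lemma target_inj:
  assumes "target x y" "target x' y"
  shows "x = x'"
proof -
  have "x \<in> scarce \<longleftrightarrow> y \<in> q ` scarce" if "target x y" for x
  proof (cases "x \<in> scarce")
    case True
    then show ?thesis using that by (simp add: target_def needed_def)
  next
    case False
    then have "free y" using that greedy_free[of x y] by (simp add: target_def del: walk.simps)
    then show ?thesis using False by (simp add: free_def)
  qed
  then have iff: "x \<in> scarce \<longleftrightarrow> x' \<in> scarce" using assms by blast
  show ?thesis
  proof (cases "x \<in> scarce")
    case True
    then show ?thesis using assms iff inj_onD[OF q_inj, of x x']
      by (simp add: target_def needed_def scarce_def)
  next
    case False
    then have "greedy y = x" "greedy y = x'"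
      using assms iff by (simp_all add: target_def del: walk.simps)
    then show ?thesis by simp
  qed
qed

text \<open>Equality of the two counts matches elements of the same position in their classes. The
  value 0 outside \<open>U\<close> only serves to make the function total.\<close>

definition graph :: "nat \<Rightarrow> nat \<Rightarrow> bool" where
  "graph x z \<longleftrightarrow> x \<notin> U \<and> z = 0 \<or>
     (\<exists>r y. (r, x) \<in> E \<and> rep E r \<and> (y, z) \<in> F \<and> cnt F y z = cnt E r x \<and> target r y)"

lemma graph_exists: "\<exists>z. graph x z"
proof (cases "x \<in> U")
  case True
  then obtain r where r: "rep E r" "(r, x) \<in> E" using rep_exists[OF E] by blast
  then obtain y where y: "target r y" using target_exists by blast
  \<comment> \<open>The bound \<open>Suc x\<close> counts \<open>x\<close> itself, which gives the
    strict inequality needed for an element at the position of \<open>x\<close>.\<close>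
  then obtain v where "cnt E r (Suc x) \<le> cnt F y v" using target_rep unfolding class_le_def by blast
  then have "cnt E r x < cnt F y v" using r by (simp add: cnt_Suc)
  then obtain z where "(y, z) \<in> F" "cnt F y z = cnt E r x" using ex_cnt_eq by blast
  then show ?thesis using r y unfolding graph_def by blast
qed (auto simp: graph_def)

section \<open>The graph defines an embedding\<close>

lemma E_subset: "E \<subseteq> U \<times> U" and F_subset: "F \<subseteq> V \<times> V"
  using E F by (auto elim: equivE)

lemma rep_common:
  assumes "rep E r" "rep E r'" "(r, x) \<in> E" "(r', x') \<in> E"
  shows "(x, x') \<in> E \<longleftrightarrow> r = r'"
proof
  assume "(x, x') \<in> E"
  then have "(r, r') \<in> E" using assms E by (meson equivE symD transD)
  then show "r = r'" by (rule rep_unique[OF E assms(1,2)])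
next
  assume "r = r'"
  then show "(x, x') \<in> E" using assms E by (meson equivE symD transD)
qed

lemma graph_unique:
  assumes "graph x z" "graph x z'"
  shows "z = z'"
proof (cases "x \<in> U")
  case True
  obtain r y where r: "(r, x) \<in> E" "rep E r" "(y, z) \<in> F" "cnt F y z = cnt E r x" "target r y"
    using assms(1) True unfolding graph_def by blast
  obtain r' y' where r': "(r', x) \<in> E" "rep E r'" "(y', z') \<in> F" "cnt F y' z' = cnt E r' x" "target r' y'"
    using assms(2) True unfolding graph_def by blast
  have "(x, x) \<in> E" using True E by (meson equivE refl_onD)
  then have "r = r'" using rep_common r r' by blast
  then have "y = y'" using target_unique r r' by blast
  then show ?thesis using cnt_inj \<open>r = r'\<close> r r' by metis
qed (use assms E_subset in \<open>auto simp: graph_def\<close>)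

definition emb :: "nat \<Rightarrow> nat" where "emb x = (THE z. graph x z)"

lemma emb_iff: "emb x = z \<longleftrightarrow> graph x z"
proof -
  have "\<exists>!z. graph x z" using graph_exists graph_unique by blast
  then show ?thesis unfolding emb_def by (metis the_equality)
qed

lemma emb_embedding: "is_embedding U E V F emb"
proof -
  have *: "\<exists>r y. (r, x) \<in> E \<and> rep E r \<and> (y, emb x) \<in> F \<and> cnt F y (emb x) = cnt E r x \<and> target r y"
    if "x \<in> U" for x
    using that emb_iff[of x "emb x"] by (simp add: graph_def)
  have iff: "(x, x') \<in> E \<longleftrightarrow> (emb x, emb x') \<in> F" and inj: "emb x = emb x' \<Longrightarrow> x = x'"
    if x: "x \<in> U" "x' \<in> U" for x x'
  proof -
    obtain r y where r: "(r, x) \<in> E" "rep E r" "(y, emb x) \<in> F" "cnt F y (emb x) = cnt E r x" "target r y"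
      using *[OF x(1)] by blast
    obtain r' y' where r': "(r', x') \<in> E" "rep E r'" "(y', emb x') \<in> F"
        "cnt F y' (emb x') = cnt E r' x'" "target r' y'"
      using *[OF x(2)] by blast
    have y: "y = y'" if "(emb x, emb x') \<in> F"
    proof (rule rep_unique[OF F])
      show "rep F y" "rep F y'" using target_rep r r' by auto
      show "(y, y') \<in> F" using r(3) r'(3) that F by (meson equivE symD transD)
    qed
    moreover have "(emb x, emb x') \<in> F" if "y = y'"
      using r(3) r'(3) that F by (meson equivE symD transD)
    ultimately have rr: "(emb x, emb x') \<in> F \<longleftrightarrow> r = r'"
      using target_inj[of r y r'] target_unique[of r y y'] r(5) r'(5) by blast
    then show "(x, x') \<in> E \<longleftrightarrow> (emb x, emb x') \<in> F"
      using rep_common[OF r(2) r'(2) r(1) r'(1)] by simp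
    assume eq: "emb x = emb x'"
    \<comment> \<open>Equal images are related, so both points lie in the same class; there the
      position determines the point.\<close>
    have "(emb x, emb x') \<in> F" using eq r(3) F by (metis equivE symD transD)
    then have "r = r'" "y = y'" using rr y by auto
    then show "x = x'" using r r' eq cnt_inj by metis
  qed
  have "emb ` U \<subseteq> V" using * F_subset by blast
  then show ?thesis using iff inj by (auto simp: is_embedding_def inj_on_def)
qed

section \<open>Certified runs of the greedy matching and the \<Sigma>3 form of the graph\<close>

abbreviation guess :: "nat \<Rightarrow> nat \<Rightarrow> nat" where
  "guess s \<equiv> walk needed (\<lambda>x i. free i \<and> entry s i = 0)"

text \<open>An entry \<open>0\<close> of \<open>s\<close> claims that the size comparison at that time holds, an entry \<open>Suc u\<close>
  claims that it fails and that \<open>u\<close> witnesses the failure.\<close>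

definition verify :: "nat \<Rightarrow> nat \<Rightarrow> nat \<Rightarrow> nat \<Rightarrow> nat \<Rightarrow> bool" where
  "verify s y i u c \<longleftrightarrow> (i \<le> y \<longrightarrow>
     (if entry s i = 0 then cnt E (guess s i) u \<le> cnt F i c
      else cnt F i u < cnt E (guess s i) (entry s i - 1)))"

text \<open>Under the prefix \<forall>\<open>u\<close> \<exists>\<open>c\<close>, an entry 0 is
  checked to be a true comparison; for a positive entry, \<open>u\<close> runs through all stages of
  the class in \<open>F\<close> and the check refutes the comparison. All answers at times up to
  \<open>y\<close> are thus correct, which fixes the run up to \<open>Suc y\<close>.\<close>

lemma verify_guess:
  assumes "\<And>i u. \<exists>c. verify s y i u c" "i \<le> Suc y"
  shows "guess s i = greedy i"
proof (rule walk_cong)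
  fix j assume "j < i"
  then have "\<exists>c. if entry s j = 0 then cnt E (guess s j) u \<le> cnt F j c
      else cnt F j u < cnt E (guess s j) (entry s j - 1)" for u
    using assms(1)[of j u] assms(2) by (simp add: verify_def)
  then have "entry s j = 0 \<longleftrightarrow> class_le E F (guess s j) j"
    unfolding class_le_def by (metis linorder_not_less)
  then show "free j \<and> entry s j = 0 \<longleftrightarrow> free j \<and> class_le E F (guess s j) j" by simp
qed

text \<open>The code lists the true answers along the greedy run up to time \<open>y\<close>, with a
  chosen witness for each failure. Looking these answers up reproduces that run.\<close>

lemma verify_exists: "\<exists>s. \<forall>i u. \<exists>c. verify s y i u c"
proof -
  define w where "w i = (if class_le E F (greedy i) i then 0
    else Suc (SOME u. \<forall>v. cnt F i v < cnt E (greedy i) u))" for i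
  obtain s where s: "\<And>i. i < Suc y \<Longrightarrow> entry s i = w i" using ex_entries[of "Suc y" w] by blast
  have eq: "greedy i = guess s i" if "i \<le> y" for i
    by (rule walk_cong) (use s that in \<open>auto simp: w_def\<close>)
  have "\<exists>c. verify s y i u c" for i u
  proof (cases "i \<le> y")
    case True
    show ?thesis
    proof (cases "class_le E F (greedy i) i")
      case le: True
      then have "class_le E F (guess s i) i" by (simp only: eq[OF True])
      then obtain c where "cnt E (guess s i) u \<le> cnt F i c" unfolding class_le_def by blast
      moreover have "entry s i = 0" using s[of i] True le by (simp add: w_def)
      ultimately have "verify s y i u c" by (simp add: verify_def)
      then show ?thesis ..
    next
      case False
      then have "\<exists>u. \<forall>v. cnt F i v < cnt E (greedy i) u"
        using class_le_def[of E F "greedy i" i] by (meson linorder_not_less)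
      then have "\<forall>v. cnt F i v < cnt E (greedy i) (SOME u. \<forall>v. cnt F i v < cnt E (greedy i) u)"
        by (rule someI_ex)
      moreover have "entry s i = Suc (SOME u. \<forall>v. cnt F i v < cnt E (greedy i) u)"
        using s[of i] True False by (simp add: w_def)
      ultimately have "entry s i \<noteq> 0" "cnt F i u < cnt E (guess s i) (entry s i - 1)"
        unfolding eq[OF True, symmetric] by simp_all
      then have "verify s y i u c" for c by (simp add: verify_def)
      then show ?thesis by blast
    qed
  qed (simp add: verify_def)
  then show ?thesis by blast
qed

text \<open>Here \<open>a\<close> codes \<open>(r, (y, s))\<close> and \<open>b\<close> codes
  \<open>(i, u)\<close>. Lying outside \<open>U\<close> is expressed by
  \<open>(x, x) \<notin> E\<close>, so that it is decided from \<open>E\<close>, and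
  \<open>q\<close> on scarce classes appears as a finite set of coded pairs.\<close>

definition matrix :: "nat \<Rightarrow> nat \<Rightarrow> nat \<Rightarrow> nat \<Rightarrow> nat \<Rightarrow> bool" where
  "matrix x z a b c \<longleftrightarrow> (x, x) \<notin> E \<and> z = 0 \<or>
     (pfst a, x) \<in> E \<and> rep E (pfst a) \<and> (pfst (psnd a), z) \<in> F \<and>
     cnt F (pfst (psnd a)) z = cnt E (pfst a) x \<and>
     (prod_encode (pfst a, pfst (psnd a)) \<in> (\<lambda>x. prod_encode (x, q x)) ` scarce \<or>
      needed (pfst a) \<and> guess (psnd (psnd a)) (pfst (psnd a)) = pfst a \<and>
      guess (psnd (psnd a)) (Suc (pfst (psnd a))) = Suc (pfst a) \<and>
      verify (psnd (psnd a)) (pfst (psnd a)) (pfst b) (psnd b) c)"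

text \<open>The greedy run involves undecidable comparisons, but any verified code forces the
  guessed run to agree with it, and a verified code always exists. One existential quantifier over
  codes thus replaces all comparisons.\<close>

lemma greedy_iff_guess:
  "greedy y = r \<and> greedy (Suc y) = Suc r \<longleftrightarrow>
    (\<exists>s. guess s y = r \<and> guess s (Suc y) = Suc r \<and> (\<forall>i u. \<exists>c. verify s y i u c))"
proof -
  have eq: "guess s y = greedy y \<and> guess s (Suc y) = greedy (Suc y)"
    if "\<forall>i u. \<exists>c. verify s y i u c" for s
    using verify_guess[of s y y] verify_guess[of s y "Suc y"] that by (simp del: walk.simps)
  show ?thesis
  proof
    assume *: "greedy y = r \<and> greedy (Suc y) = Suc r"
    obtain s where s: "\<forall>i u. \<exists>c. verify s y i u c" using verify_exists by blast
    then have "guess s y = r \<and> guess s (Suc y) = Suc r" using eq[OF s] * by (simp del: walk.simps)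
    then show "\<exists>s. guess s y = r \<and> guess s (Suc y) = Suc r \<and> (\<forall>i u. \<exists>c. verify s y i u c)"
      using s by blast
  next
    assume "\<exists>s. guess s y = r \<and> guess s (Suc y) = Suc r \<and> (\<forall>i u. \<exists>c. verify s y i u c)"
    then obtain s where s: "guess s y = r" "guess s (Suc y) = Suc r" "\<forall>i u. \<exists>c. verify s y i u c"
      by blast
    show "greedy y = r \<and> greedy (Suc y) = Suc r"
      using eq[OF s(3)] s(1,2) by (simp del: walk.simps)
  qed
qed

lemma graph_Sigma3: "graph x z \<longleftrightarrow> (\<exists>a. \<forall>b. \<exists>c. matrix x z a b c)"
proof -
  define K where "K r y s \<longleftrightarrow> x \<notin> U \<and> z = 0 \<or>
     (r, x) \<in> E \<and> rep E r \<and> (y, z) \<in> F \<and> cnt F y z = cnt E r x \<and>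
       (r \<in> scarce \<and> y = q r \<or> needed r \<and> guess s y = r \<and> guess s (Suc y) = Suc r \<and>
         (\<forall>i u. \<exists>c. verify s y i u c))" for r y s
  have xU: "(x, x) \<in> E \<longleftrightarrow> x \<in> U"
    using E E_subset by (meson equivE mem_Sigma_iff refl_onD subsetD)
  have table: "prod_encode (r, y) \<in> (\<lambda>x. prod_encode (x, q x)) ` scarce \<longleftrightarrow> r \<in> scarce \<and> y = q r" for r y
    by (auto simp: prod_encode_eq)
  have unpair: "(\<forall>b. Q (pfst b) (psnd b)) \<longleftrightarrow> (\<forall>i u. Q i u)" for Q :: "nat \<Rightarrow> nat \<Rightarrow> bool"
    by (metis pfst_encode psnd_encode)
  \<comment> \<open>Only the verification depends on \<open>b\<close> and \<open>c\<close>, so both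
    quantifiers can be moved inward to it.\<close>
  have pull: "(\<forall>b. \<exists>c. A \<or> B1 \<and> B2 \<and> B3 \<and> B4 \<and> (T \<or> C1 \<and> C2 \<and> C3 \<and> P b c)) \<longleftrightarrow>
      A \<or> B1 \<and> B2 \<and> B3 \<and> B4 \<and> (T \<or> C1 \<and> C2 \<and> C3 \<and> (\<forall>b. \<exists>c. P b c))"
    for A B1 B2 B3 B4 T C1 C2 C3 and P :: "nat \<Rightarrow> nat \<Rightarrow> bool"
    by blast
  have "(\<forall>b. \<exists>c. matrix x z a b c) \<longleftrightarrow> K (pfst a) (pfst (psnd a)) (psnd (psnd a))" for a
    unfolding matrix_def table xU pull K_def
    unfolding unpair[of "\<lambda>i u. \<exists>c. verify (psnd (psnd a)) (pfst (psnd a)) i u c"] by (rule refl)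
  then have "(\<exists>a. \<forall>b. \<exists>c. matrix x z a b c) \<longleftrightarrow>
      (\<exists>a. K (pfst a) (pfst (psnd a)) (psnd (psnd a)))" by simp
  also have "\<dots> \<longleftrightarrow> (\<exists>r y s. K r y s)" by (metis pfst_encode psnd_encode)
  also have "\<dots> \<longleftrightarrow> graph x z"
    unfolding graph_def target_def greedy_iff_guess K_def by blast
  finally show ?thesis ..
qed

lemma Delta3_emb:
  assumes decE: "rel_computable Ora 2 (\<lambda>xs. (xs ! 0, xs ! 1) \<in> E)"
    and decF: "rel_computable Ora 2 (\<lambda>xs. (xs ! 0, xs ! 1) \<in> F)"
  shows "Delta3_fun Ora emb"
proof (rule Delta3_funI)
  have mem: "rel_computable Ora k (\<lambda>xs. (f xs, g xs) \<in> E)" "rel_computable Ora k (\<lambda>xs. (f xs, g xs) \<in> F)"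
    if "computable Ora k f" "computable Ora k g" for k f g
    using computable_compose2[OF decE[unfolded rel_computable_iff] that]
      computable_compose2[OF decF[unfolded rel_computable_iff] that]
    by (simp_all add: rel_computable_iff)
  note cnt = computable_cnt[OF decE] computable_cnt[OF decF]
  have needed: "rel_computable Ora k (\<lambda>xs. needed (f xs))" if "computable Ora k f" for k f
    unfolding needed_def rep_def
    by (intro computable_intros mem cnt rel_computable_finite finite_scarce that)
  have free: "rel_computable Ora k (\<lambda>xs. free (f xs))" if "computable Ora k f" for k f
    unfolding free_def rep_def
    by (intro computable_intros mem cnt rel_computable_finite finite_imageI finite_scarce that)
  have guess: "computable Ora k (\<lambda>xs. guess (f xs) (g xs))"
    if "computable Ora k f" "computable Ora k g" for k f g
    by (rule computable_walk[where S = "\<lambda>s i. free i \<and> entry s i = 0"])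
      (intro needed free computable_intros computable_entry computable_proj that; simp)+
  \<comment> \<open>The conditional in \<open>verify\<close> is Boolean, whereas
    \<open>computable_if\<close> treats numerical values; it is rewritten into implications
    first.\<close>
  show "rel_computable Ora 5 (\<lambda>xs. matrix (xs ! 0) (xs ! 1) (xs ! 2) (xs ! 3) (xs ! 4))"
    unfolding matrix_def verify_def rep_def if_bool_eq_conj
    by (intro computable_intros mem cnt needed guess rel_computable_finite finite_imageI finite_scarce
        computable_entry computable_proj) simp_all
qed (simp add: emb_iff graph_Sigma3)

end

text \<open>The oracle is arbitrary as long as it decides both relations, so the two directions of
  bi-embeddability can be treated separately over the same join.\<close>

lemma Delta3_embedding:
  assumes "equiv U E" "equiv V F" "is_embedding U E V F f"
    and "rel_computable Ora 2 (\<lambda>xs. (xs ! 0, xs ! 1) \<in> E)"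
    and "rel_computable Ora 2 (\<lambda>xs. (xs ! 0, xs ! 1) \<in> F)"
  shows "\<exists>g. is_embedding U E V F g \<and> Delta3_fun Ora g"
proof -
  obtain q where "inj_on q {x. rep E x}" "\<forall>x. rep E x \<longrightarrow> rep F (q x) \<and> class_le E F x (q x)"
    using embedding_on_reps[OF assms(1-3)] by blast
  then interpret class_matching U E V F q
    using assms by unfold_locales auto
  show ?thesis using emb_embedding Delta3_emb assms(4,5) by blast
qed

theorem theorem3p11:
  fixes U :: "nat set" and E :: "(nat \<times> nat) set"
  assumes "equiv_structure U E"
  shows "rel_Delta3_bi_emb_categorical U E"
  unfolding rel_Delta3_bi_emb_categorical_def
proof (intro allI impI, elim conjE)
  fix V F
  assume F: "equiv_structure V F" and bi: "bi_embeddable U E V F"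
  let ?Ora = "join (diagram U E) (diagram V F)"
  let ?n = "\<lambda>xs. prod_encode (xs ! 0, xs ! 1)"
  have n: "computable ?Ora 2 ?n" by (intro computable_prod_encode computable_proj) simp_all
  \<comment> \<open>The outer factor 2 selects the first half of the join, and the odd index
    \<open>2 * n + 1\<close> asks the diagram about the pair coded by \<open>n\<close>.\<close>
  have "(\<lambda>xs. ?Ora (2 * (2 * ?n xs + 1))) = (\<lambda>xs. (xs ! 0, xs ! 1) \<in> E)"
    by (simp add: join_def diagram_def)
  moreover have "rel_computable ?Ora 2 (\<lambda>xs. ?Ora (2 * (2 * ?n xs + 1)))"
    by (intro rel_computable_oracle computable_mult computable_add computable_const n)
  ultimately have decE: "rel_computable ?Ora 2 (\<lambda>xs. (xs ! 0, xs ! 1) \<in> E)" by simp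
  \<comment> \<open>The final \<open>+ 1\<close> moves the same query to the second half of the
    join.\<close>
  have "(\<lambda>xs. ?Ora (2 * (2 * ?n xs + 1) + 1)) = (\<lambda>xs. (xs ! 0, xs ! 1) \<in> F)"
    by (simp add: join_def diagram_def)
  moreover have "rel_computable ?Ora 2 (\<lambda>xs. ?Ora (2 * (2 * ?n xs + 1) + 1))"
    by (intro rel_computable_oracle computable_mult computable_add computable_const n)
  ultimately have decF: "rel_computable ?Ora 2 (\<lambda>xs. (xs ! 0, xs ! 1) \<in> F)" by simp
  have "equiv U E" "equiv V F" using assms F by (simp_all add: equiv_structure_def)
  then show "\<exists>f g. is_embedding U E V F f \<and> is_embedding V F U E g \<and> Delta3_fun ?Ora f \<and> Delta3_fun ?Ora g"
    using bi Delta3_embedding[OF _ _ _ decE decF] Delta3_embedding[OF _ _ _ decF decE]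
    unfolding bi_embeddable_def by metis
qed

end
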